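(* Let $S\subset V$ be any subset such that $s\in S$ and $d\in N_S$. Then $$C_{opt}(s,d)\ \ge\ \min\bigl(R^*_{opt}(S,N_S\setminus\{d\}),\ R^*_{opt}(S,\{d\})\bigr).$$
   Context: Setting. $V$ is a finite set of vertices and $E$ is a set of directed edges joining vertices of $V$. Each $v\in V$ is associated with a non-empty compact convex set $\mathcal{X}_v\subset\mathbb{R}^n$. For $x_u\in\mathcal{X}_u$, $x_v\in\mathcal{X}_v$ the travel cost of edge $(u,v)$ is $cost(x_u,x_v):=\lVert x_u-x_v\rVert_2$. A path in $(V,E)$ is a sequence of vertices $(v_1,\dots,v_k)$ with $(v_i,v_{i+1})\in E$; given points $x_{v_i}\in\mathcal{X}_{v_i}$, the cost of traveling it is $\sum_{i=1}^{k-1}cost(x_{v_i},x_{v_{i+1}})$. SPP-GCS. For $u\in V$, the SPP-GCS from $u$ to $d$ is to find a path $(v_1,\dots,v_k)$ with $v_1=u$, $v_k=d$ and points $x_{v_i}\in\mathcal{X}_{v_i}$ minimizing the cost of traveling the path; its optimal cost is $C_{opt}(u,d)$ ($+\infty$ if there is no path). The origin is $s\in V$ and the destination is $d\in V$. It is assumed that $(V,E)$ contains at least one path from $s$ to $d$. Heuristic. $h:V\to\mathbb{R}$ is a given admissible function: $h(v)\le C_{opt}(v,d)$ for all $v\in V$, and $h(d)=0$. For $S\subset V$, $N_S:=\{v: u\in S,\ v\notin S,\ (u,v)\in E\}$ (so $d\in N_S$ implies $d\notin S$). Relaxation. The perspective of a compact convex set $\mathcal{X}\subset\mathbb{R}^n$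 is $\overline{\mathcal{X}}:=\{(x,\lambda):\lambda\ge 0,\ x\in\lambda\mathcal{X}\}$. For $S\subset V$ with $s\in S$, $d\notin S$ and $S'\subseteq N_S$, let $\overline{V}:=S\cup S'$, $\overline{E}:=\{(u,v)\in E: u\in S,\ v\in\overline{V}\}$, and let $\delta^+(v)$, $\delta^-(v)$ be the edges of $\overline{E}$ leaving, respectively entering, $v$. $R^*_{opt}(S,S')$ is the optimal value of the convex program $$\min\ \sum_{(u,v)\in\overline{E}}\lVert z_{uv}-z'_{uv}\rVert_2+\sum_{v\in S'}\alpha_v h(v)$$ over $z_{uv},z'_{uv}\in\mathbb{R}^n$, $y_{uv}\in\mathbb{R}$ for $(u,v)\in\overline{E}$ and $\alpha_v\in\mathbb{R}$ for $v\in S'$, subject to: $\sum_{v\in S'}\alpha_v=1$; $\sum_{(s,v)\in\overline{E}}y_{sv}=1$; $\sum_{(u,v)\in\overline{E}}y_{uv}=\alpha_v$ for each $v\in S'$; $\sum_{(u,v)\in\delta^-(v)}(z'_{uv},y_{uv})=\sum_{(v,u)\in\delta^+(v)}(z_{vu},y_{vu})$ for each $v\in S\setminus\{s\}$; $(z_{uv},y_{uv})\in\overline{\mathcal{X}}_u$ and $(z'_{uv},y_{uv})\in\overline{\mathcal{X}}_v$ for each $(u,v)\in\overline{E}$; $0\le y_{uv}\le 1$ for each $(u,v)\in\overline{E}$; $0\le\alpha_v\le 1$ for each $v\in S'$. If the program is infeasible (in particular if $S'=\emptyset$), $R^*_{opt}(S,S'):=+\infty$. *)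

theory Defs
  imports "HOL-Analysis.Analysis"
begin

definition travel_cost :: "real ^ 'n \<Rightarrow> real ^ 'n \<Rightarrow> real" where
  "travel_cost x y = norm (x - y)"

definition is_path :: "'v set \<Rightarrow> ('v \<times> 'v) set \<Rightarrow> 'v list \<Rightarrow> bool" where
  "is_path V E p \<longleftrightarrow> p \<noteq> [] \<and> set p \<subseteq> V \<and> successively (\<lambda>u v. (u, v) \<in> E) p"

text \<open>Vertices may repeat in a path, and the chosen points are indexed by vertices. Letting
  the point vary between visits of the same vertex gives the same optimal cost:
  cutting out the closed part of the path between two visits does not increase the cost,
  by the triangle inequality.\<close>

definition path_cost :: "('v \<Rightarrow> real ^ 'n) \<Rightarrow> 'v list \<Rightarrow> real" where
  "path_cost x p = (\<Sum>i<length p - 1. travel_cost (x (p ! i)) (x (p ! Suc i)))"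

text \<open>The infimum over the empty set is \<open>\<infinity>\<close>.\<close>

definition C_opt ::
  "'v set \<Rightarrow> ('v \<times> 'v) set \<Rightarrow> ('v \<Rightarrow> (real ^ 'n) set) \<Rightarrow> 'v \<Rightarrow> 'v \<Rightarrow> ereal" where
  "C_opt V E X u d =
     Inf {ereal (path_cost x p) | p x.
            is_path V E p \<and> hd p = u \<and> last p = d \<and> (\<forall>v\<in>set p. x v \<in> X v)}"

definition out_nbrs :: "('v \<times> 'v) set \<Rightarrow> 'v set \<Rightarrow> 'v set" where
  "out_nbrs E S = {v. v \<notin> S \<and> (\<exists>u\<in>S. (u, v) \<in> E)}"

definition perspective :: "(real ^ 'n) set \<Rightarrow> ((real ^ 'n) \<times> real) set" where
  "perspective A = {(x, l). l \<ge> 0 \<and> x \<in> (\<lambda>a. l *\<^sub>R a) ` A}"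

definition relax_edges :: "('v \<times> 'v) set \<Rightarrow> 'v set \<Rightarrow> 'v set \<Rightarrow> ('v \<times> 'v) set" where
  "relax_edges E S S' = {(u, v) \<in> E. u \<in> S \<and> v \<in> S \<union> S'}"

definition out_edges :: "('v \<times> 'v) set \<Rightarrow> 'v \<Rightarrow> ('v \<times> 'v) set" where
  "out_edges F v = {e \<in> F. fst e = v}"

definition in_edges :: "('v \<times> 'v) set \<Rightarrow> 'v \<Rightarrow> ('v \<times> 'v) set" where
  "in_edges F v = {e \<in> F. snd e = v}"

text \<open>The decision variables are total functions; only their values on the edges
  \<open>relax_edges E S S'\<close> and on \<open>S'\<close> occur in the constraints and in the objective.\<close>

definition relax_feasible ::
  "('v \<times> 'v) set \<Rightarrow> ('v \<Rightarrow> (real ^ 'n) set) \<Rightarrow> 'v \<Rightarrow> 'v set \<Rightarrow> 'v set \<Rightarrow>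
   ('v \<times> 'v \<Rightarrow> real ^ 'n) \<Rightarrow> ('v \<times> 'v \<Rightarrow> real ^ 'n) \<Rightarrow> ('v \<times> 'v \<Rightarrow> real) \<Rightarrow> ('v \<Rightarrow> real) \<Rightarrow> bool" where
  "relax_feasible E X s S S' z z' y \<alpha> \<longleftrightarrow>
     (let F = relax_edges E S S' in
       (\<Sum>v\<in>S'. \<alpha> v) = 1 \<and>
       (\<Sum>e\<in>out_edges F s. y e) = 1 \<and>
       (\<forall>v\<in>S'. (\<Sum>e\<in>in_edges F v. y e) = \<alpha> v) \<and>
       (\<forall>v\<in>S - {s}. (\<Sum>e\<in>in_edges F v. (z' e, y e)) = (\<Sum>e\<in>out_edges F v. (z e, y e))) \<and>
       (\<forall>(u, v)\<in>F. (z (u, v), y (u, v)) \<in> perspective (X u) \<and>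
                    (z' (u, v), y (u, v)) \<in> perspective (X v)) \<and>
       (\<forall>e\<in>F. 0 \<le> y e \<and> y e \<le> 1) \<and>
       (\<forall>v\<in>S'. 0 \<le> \<alpha> v \<and> \<alpha> v \<le> 1))"

definition relax_objective ::
  "('v \<times> 'v) set \<Rightarrow> ('v \<Rightarrow> real) \<Rightarrow> 'v set \<Rightarrow> 'v set \<Rightarrow>
   ('v \<times> 'v \<Rightarrow> real ^ 'n) \<Rightarrow> ('v \<times> 'v \<Rightarrow> real ^ 'n) \<Rightarrow> ('v \<Rightarrow> real) \<Rightarrow> real" where
  "relax_objective E h S S' z z' \<alpha> =
     (\<Sum>e\<in>relax_edges E S S'. norm (z e - z' e)) + (\<Sum>v\<in>S'. \<alpha> v * h v)"

definition R_opt ::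
  "('v \<times> 'v) set \<Rightarrow> ('v \<Rightarrow> (real ^ 'n) set) \<Rightarrow> ('v \<Rightarrow> real) \<Rightarrow> 'v \<Rightarrow> 'v set \<Rightarrow> 'v set \<Rightarrow> ereal" where
  "R_opt E X h s S S' =
     Inf {ereal (relax_objective E h S S' z z' \<alpha>) | z z' y \<alpha>.
            relax_feasible E X s S S' z z' y \<alpha>}"

end

theory Submission
  imports Defs
begin

text \<open>
  Fix a path from \<open>s\<close> to \<open>d\<close> together with points of the regions. It starts inside \<open>S\<close> and ends
  outside, so it has a first vertex \<open>w\<close> outside \<open>S\<close>, and \<open>w\<close> is an out-neighbour of \<open>S\<close>. The part
  from \<open>w\<close> on is a path to \<open>d\<close> and costs at least \<open>h w\<close> by admissibility. The part up to \<open>w\<close> uses,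
  apart from \<open>w\<close>, only vertices of \<open>S\<close>. Once its cycles are cut out (lemma
  \<open>exists_distinct_path\<close>), sending one unit of flow along it is feasible for the relaxation of
  every \<open>S'\<close> that contains \<open>w\<close>, with objective equal to its cost plus \<open>h w\<close> (lemma
  \<open>R_opt_le_distinct_path\<close>). Taking \<open>S' = {d}\<close> if \<open>w = d\<close>, and the remaining out-neighbours
  otherwise, bounds one of the two relaxations by the cost of the given path.

  Cutting out the cycles is what makes the flow respect \<open>y \<le> 1\<close> and send exactly one unit out of
  \<open>s\<close>. It does not increase the cost since the points are attached to vertices: both ends of a
  cycle are the same point, so that only nonnegative terms disappear.
\<close>

section \<open>Costs of paths\<close>

lemma path_cost_singleton [simp]: "path_cost x [a] = 0"
  by (simp add: path_cost_def)

lemma path_cost_Cons_Cons [simp]: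
  "path_cost x (a # b # p) = travel_cost (x a) (x b) + path_cost x (b # p)"
  by (simp add: path_cost_def sum.lessThan_Suc_shift del: sum.lessThan_Suc)

lemma path_cost_nonneg: "0 \<le> path_cost x p"
  by (simp add: path_cost_def travel_cost_def sum_nonneg)

lemma path_cost_split:
  "path_cost x (p @ a # q) = path_cost x (p @ [a]) + path_cost x (a # q)"
proof (induction p)
  case (Cons b p)
  then show ?case by (cases p) simp_all
qed simp

lemma exists_distinct_path:
  assumes "p \<noteq> []" "successively R p"
  shows "\<exists>q. q \<noteq> [] \<and> distinct q \<and> successively R q \<and> hd q = hd p \<and> last q = last p \<and>
             set q \<subseteq> set p \<and> path_cost x q \<le> path_cost x p"
  using assms
proof (induction p rule: induct_list012)
  case (3 a b p)
  then obtain q where q: "q \<noteq> []" "distinct q" "successively R q" "hd q = b"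
    "last q = last (b # p)" "set q \<subseteq> set (b # p)" "path_cost x q \<le> path_cost x (b # p)"
    by auto
  have cost: "path_cost x q \<le> path_cost x (a # b # p)"
    using q(7) by (simp add: travel_cost_def add_increasing)
  show ?case
  proof (cases "a \<in> set q")
    case True
    \<comment> \<open>The path returns to \<open>a\<close>, so it may as well start at that later visit.\<close>
    then obtain q1 q2 where split: "q = q1 @ a # q2"
      by (meson split_list)
    have "path_cost x (a # q2) \<le> path_cost x q"
      using path_cost_nonneg[of x "q1 @ [a]"] path_cost_split[of x q1 a q2] by (simp add: split)
    then show ?thesis
      using q cost by (intro exI[of _ "a # q2"]) (auto simp: split successively_append_iff)
  next
    case False
    obtain q' where "q = b # q'"
      using q(1,4) by (cases q) auto
    then show ?thesis
      using q False "3.prems" by (intro exI[of _ "a # q"]) auto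
  qed
qed (auto intro: exI[of _ "[_]"])

section \<open>Edges of simple paths\<close>

definition path_edges :: "'v list \<Rightarrow> ('v \<times> 'v) set" where
  "path_edges p = set (zip p (tl p))"

lemma finite_path_edges [simp]: "finite (path_edges p)"
  by (simp add: path_edges_def)

lemma path_edges_simps [simp]:
  "path_edges [] = {}"
  "path_edges [a] = {}"
  "path_edges (a # b # p) = insert (a, b) (path_edges (b # p))"
  by (simp_all add: path_edges_def)

lemma path_edges_subset:
  assumes "successively (\<lambda>u v. (u, v) \<in> E) p"
  shows "path_edges p \<subseteq> E \<inter> set (butlast p) \<times> set p"
  using assms by (induction p rule: induct_list012) auto

lemma path_edges_subset_set: "path_edges p \<subseteq> set p \<times> set p"
  by (induction p rule: induct_list012) auto

lemma path_cost_eq_sum_edges: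
  assumes "distinct p"
  shows "path_cost x p = (\<Sum>e\<in>path_edges p. travel_cost (x (fst e)) (x (snd e)))"
  using assms
proof (induction p rule: induct_list012)
  case (3 a b p)
  have "(a, b) \<notin> path_edges (b # p)"
    using 3(3) path_edges_subset_set[of "b # p"] by auto
  then show ?case using 3 by simp
qed (simp_all add: path_cost_def)

lemma card_path_edges_leaving:
  assumes "distinct p"
  shows "card {e \<in> path_edges p. fst e = v} = (if v \<in> set (butlast p) then 1 else 0)"
  using assms
proof (induction p rule: induct_list012)
  case (3 a b p)
  have a: "a \<notin> set (butlast (b # p))"
    using 3(3) by (meson distinct.simps(2) in_set_butlastD)
  have "{e \<in> path_edges (a # b # p). fst e = v} =
        (if v = a then insert (a, b) else id) {e \<in> path_edges (b # p). fst e = v}"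
    by auto
  moreover have "(a, b) \<notin> path_edges (b # p)"
    using 3(3) path_edges_subset_set[of "b # p"] by auto
  ultimately have "card {e \<in> path_edges (a # b # p). fst e = v} =
                   (if v = a then 1 else 0) + card {e \<in> path_edges (b # p). fst e = v}"
    by simp
  then show ?case using 3 a by (auto simp del: path_edges_simps)
qed simp_all

lemma card_path_edges_entering:
  assumes "distinct p"
  shows "card {e \<in> path_edges p. snd e = v} = (if v \<in> set (tl p) then 1 else 0)"
  using assms
proof (induction p rule: induct_list012)
  case (3 a b p)
  have "{e \<in> path_edges (a # b # p). snd e = v} =
        (if v = b then insert (a, b) else id) {e \<in> path_edges (b # p). snd e = v}"
    by auto
  moreover have "(a, b) \<notin> path_edges (b # p)"
    using 3(3) path_edges_subset_set[of "b # p"] by auto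
  ultimately have "card {e \<in> path_edges (a # b # p). snd e = v} =
                   (if v = b then 1 else 0) + card {e \<in> path_edges (b # p). snd e = v}"
    by simp
  then show ?case using 3 by (auto simp del: path_edges_simps)
qed simp_all

section \<open>The unit flow along a simple path\<close>

text \<open>
  The values \<open>g\<close> lie in an arbitrary real vector space so that the next two lemmas serve both the
  amounts of flow, in \<open>real\<close>, and the pairs of a point and an amount in the conservation constraint.
\<close>

lemma sum_out_edges_distinct_path:
  fixes g :: "'v \<Rightarrow> 'b::real_vector"
  assumes "finite F" "path_edges p \<subseteq> F" "distinct p"
  shows "(\<Sum>e\<in>out_edges F v. if e \<in> path_edges p then g (fst e) else 0) =
         (if v \<in> set (butlast p) then g v else 0)"
proof -
  have "(\<Sum>e\<in>out_edges F v. if e \<in> path_edges p then g (fst e) else 0) =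
        (\<Sum>e\<in>{e \<in> path_edges p. fst e = v}. g v)"
    using assms(1,2) by (intro sum.mono_neutral_cong_right) (auto simp: out_edges_def)
  then show ?thesis
    using card_path_edges_leaving[OF assms(3), of v] by (simp only: sum_constant_scaleR) simp
qed

lemma sum_in_edges_distinct_path:
  fixes g :: "'v \<Rightarrow> 'b::real_vector"
  assumes "finite F" "path_edges p \<subseteq> F" "distinct p"
  shows "(\<Sum>e\<in>in_edges F v. if e \<in> path_edges p then g (snd e) else 0) =
         (if v \<in> set (tl p) then g v else 0)"
proof -
  have "(\<Sum>e\<in>in_edges F v. if e \<in> path_edges p then g (snd e) else 0) =
        (\<Sum>e\<in>{e \<in> path_edges p. snd e = v}. g v)"
    using assms(1,2) by (intro sum.mono_neutral_cong_right) (auto simp: in_edges_def)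
  then show ?thesis
    using card_path_edges_entering[OF assms(3), of v] by (simp only: sum_constant_scaleR) simp
qed

text \<open>
  An edge of the path carries one unit of flow and the points of its two ends, every other edge
  carries \<open>0\<close>. As the path is simple, it enters and leaves each inner vertex \<open>v\<close> exactly once,
  both times with \<open>(x v, 1)\<close>. The regions off the path have to be nonempty because the
  perspective of the empty set does not contain \<open>(0, 0)\<close>.
\<close>

lemma R_opt_le_distinct_path:
  fixes X :: "'v \<Rightarrow> (real ^ 'n) set" and x :: "'v \<Rightarrow> real ^ 'n"
  assumes finE: "finite E"
    and X: "\<And>u v. (u, v) \<in> E \<Longrightarrow> X u \<noteq> {} \<and> X v \<noteq> {}"
    and S': "finite S'" "w \<in> S'" "S \<inter> S' = {}"
    and s: "s \<in> S"
    and p: "p \<noteq> []" "distinct p" "successively (\<lambda>u v. (u, v) \<in> E) p" "hd p = s" "last p = w"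
      "set p \<subseteq> insert w S"
    and x: "\<forall>v\<in>set p. x v \<in> X v"
  shows "R_opt E X h s S S' \<le> ereal (path_cost x p + h w)"
proof -
  define F where "F = relax_edges E S S'"
  define P where "P = path_edges p"
  define y where "y = (\<lambda>e. if e \<in> P then 1 else 0 :: real)"
  define z where "z = (\<lambda>e. if e \<in> P then x (fst e) else 0)"
  define z' where "z' = (\<lambda>e. if e \<in> P then x (snd e) else 0)"
  define \<alpha> where "\<alpha> = (\<lambda>v. if v = w then 1 else 0 :: real)"
  have w: "w \<noteq> s" "w \<notin> S"
    using S' s by auto
  have butlast: "set (butlast p) = set p - {w}"
    using p(1,2,5) by (cases p rule: rev_cases) auto
  have tl: "set (tl p) = set p - {s}"
    using p(1,2,4) by (cases p) auto
  have ends: "s \<in> set p" "w \<in> set p"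
    using p(1,4,5) by auto
  have finF: "finite F"
    by (rule finite_subset[OF _ finE]) (auto simp: F_def relax_edges_def)
  have PF: "P \<subseteq> F"
    using path_edges_subset[OF p(3)] p(6) S'(2)
    by (auto simp: P_def F_def relax_edges_def butlast)
  note out = sum_out_edges_distinct_path[OF finF PF[unfolded P_def] p(2), folded P_def, unfolded butlast]
  note into = sum_in_edges_distinct_path[OF finF PF[unfolded P_def] p(2), folded P_def, unfolded tl]
  have out_y: "(\<Sum>e\<in>out_edges F v. y e) = (if v \<in> set p - {w} then 1 else 0)" for v
    using out[where v = v and g = "\<lambda>_. 1::real"] by (simp add: y_def)
  have in_y: "(\<Sum>e\<in>in_edges F v. y e) = (if v \<in> set p - {s} then 1 else 0)" for v
    using into[where v = v and g = "\<lambda>_. 1::real"] by (simp add: y_def)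
  have zy: "(z e, y e) = (if e \<in> P then (x (fst e), 1) else 0)"
    and z'y: "(z' e, y e) = (if e \<in> P then (x (snd e), 1) else 0)" for e
    by (simp_all add: z_def z'_def y_def zero_prod_def)
  have out_zy: "(\<Sum>e\<in>out_edges F v. (z e, y e)) = (if v \<in> set p - {w} then (x v, 1) else 0)" for v
    unfolding zy by (rule out)
  have in_zy: "(\<Sum>e\<in>in_edges F v. (z' e, y e)) = (if v \<in> set p - {s} then (x v, 1) else 0)" for v
    unfolding z'y by (rule into)
  have persp: "(z (u, v), y (u, v)) \<in> perspective (X u) \<and> (z' (u, v), y (u, v)) \<in> perspective (X v)"
    if "(u, v) \<in> F" for u v
  proof (cases "(u, v) \<in> P")
    case True
    then have "u \<in> set p" "v \<in> set p"
      using path_edges_subset_set[of p] by (auto simp: P_def)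
    with True x show ?thesis
      by (auto simp: perspective_def y_def z_def z'_def)
  next
    case False
    have "X u \<noteq> {}" "X v \<noteq> {}"
      using that X by (auto simp: F_def relax_edges_def)
    with False show ?thesis
      by (auto simp: perspective_def y_def z_def z'_def image_iff)
  qed
  have "relax_feasible E X s S S' z z' y \<alpha>"
    unfolding relax_feasible_def Let_def F_def[symmetric]
  proof (intro conjI)
    show "(\<Sum>v\<in>S'. \<alpha> v) = 1"
      using S' by (simp add: \<alpha>_def)
    show "(\<Sum>e\<in>out_edges F s. y e) = 1"
      using ends w by (simp add: out_y)
    show "\<forall>v\<in>S'. (\<Sum>e\<in>in_edges F v. y e) = \<alpha> v"
      using ends w p(6) S' by (auto simp: in_y \<alpha>_def)
    show "\<forall>v\<in>S - {s}. (\<Sum>e\<in>in_edges F v. (z' e, y e)) = (\<Sum>e\<in>out_edges F v. (z e, y e))"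
      using w by (auto simp: in_zy out_zy)
    show "\<forall>(u, v)\<in>F. (z (u, v), y (u, v)) \<in> perspective (X u) \<and>
                      (z' (u, v), y (u, v)) \<in> perspective (X v)"
      using persp by blast
  qed (auto simp: y_def \<alpha>_def)
  then have "R_opt E X h s S S' \<le> ereal (relax_objective E h S S' z z' \<alpha>)"
    unfolding R_opt_def by (intro Inf_lower) blast
  also have "relax_objective E h S S' z z' \<alpha> = path_cost x p + h w"
  proof -
    have "(\<Sum>e\<in>F. norm (z e - z' e)) = (\<Sum>e\<in>P. travel_cost (x (fst e)) (x (snd e)))"
      using finF PF
      by (intro sum.mono_neutral_cong_right) (auto simp: z_def z'_def travel_cost_def)
    moreover have "(\<Sum>v\<in>S'. \<alpha> v * h v) = (\<Sum>v\<in>S'. if v = w then h v else 0)"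
      by (intro sum.cong) (auto simp: \<alpha>_def)
    ultimately show ?thesis
      using S' by (simp add: relax_objective_def F_def P_def path_cost_eq_sum_edges[OF p(2)])
  qed
  finally show ?thesis .
qed

section \<open>The lower bound\<close>

theorem theorem2:
  fixes V :: "'v set" and E :: "('v \<times> 'v) set" and X :: "'v \<Rightarrow> (real ^ 'n) set"
    and h :: "'v \<Rightarrow> real" and s d :: 'v and S :: "'v set"
  assumes "finite V" and "E \<subseteq> V \<times> V"
    and "\<And>v. v \<in> V \<Longrightarrow> X v \<noteq> {} \<and> compact (X v) \<and> convex (X v)"
    and "s \<in> V" and "d \<in> V"
    and "\<exists>p. is_path V E p \<and> hd p = s \<and> last p = d"
    and "\<And>v. v \<in> V \<Longrightarrow> ereal (h v) \<le> C_opt V E X v d" and "h d = 0"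
    and "S \<subseteq> V" and "s \<in> S" and "d \<in> out_nbrs E S"
  shows "C_opt V E X s d
           \<ge> min (R_opt E X h s S (out_nbrs E S - {d})) (R_opt E X h s S {d})"
proof -
  have finE: "finite E"
    using assms(1,2) finite_subset by blast
  have nonempty: "X u \<noteq> {} \<and> X v \<noteq> {}" if "(u, v) \<in> E" for u v
    using that assms(2,3) by blast
  have "finite (out_nbrs E S)"
    by (rule finite_subset[OF _ assms(1)]) (use assms(2) in \<open>auto simp: out_nbrs_def\<close>)
  have "min (R_opt E X h s S (out_nbrs E S - {d})) (R_opt E X h s S {d}) \<le> ereal (path_cost x p)"
    if path: "is_path V E p" "hd p = s" "last p = d" and x: "\<forall>v\<in>set p. x v \<in> X v" for p x
  proof -
    have "d \<in> set p" "d \<notin> S"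
      using path assms(11) by (auto simp: is_path_def out_nbrs_def)
    then obtain p1 w p2 where split: "p = p1 @ w # p2" and w: "w \<notin> S" and p1: "set p1 \<subseteq> S"
      using split_list_first_prop[of p "\<lambda>v. v \<notin> S"] by blast
    have "p1 \<noteq> []"
      using split w path(2) assms(10) by auto
    have succ: "successively (\<lambda>u v. (u, v) \<in> E) (p1 @ [w])" "successively (\<lambda>u v. (u, v) \<in> E) (w # p2)"
      and "(last p1, w) \<in> E"
      using path(1) \<open>p1 \<noteq> []\<close> by (auto simp: is_path_def split successively_append_iff)
    then have nbr: "w \<in> out_nbrs E S"
      using w p1 last_in_set[OF \<open>p1 \<noteq> []\<close>] by (auto simp: out_nbrs_def)
    obtain q where q: "q \<noteq> []" "distinct q" "successively (\<lambda>u v. (u, v) \<in> E) q"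
      "hd q = s" "last q = w" "set q \<subseteq> insert w (set p1)"
      and cost_q: "path_cost x q \<le> path_cost x (p1 @ [w])"
      using exists_distinct_path[OF _ succ(1), of x] path(2) \<open>p1 \<noteq> []\<close> by (auto simp: split)
    have R: "R_opt E X h s S S' \<le> ereal (path_cost x q + h w)"
      if "finite S'" "w \<in> S'" "S' \<subseteq> out_nbrs E S" for S'
    proof (rule R_opt_le_distinct_path[OF finE nonempty that(1,2) _ assms(10) q(1-5)])
      show "S \<inter> S' = {}"
        using that(3) by (auto simp: out_nbrs_def)
      show "set q \<subseteq> insert w S"
        using q(6) p1 by blast
      show "\<forall>v\<in>set q. x v \<in> X v"
        using q(6) x by (auto simp: split)
    qed
    have "w \<in> V"
      using path(1) by (simp add: is_path_def split)
    then have "ereal (h w) \<le> C_opt V E X w d"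
      by (rule assms(7))
    also have "\<dots> \<le> ereal (path_cost x (w # p2))"
      unfolding C_opt_def
    proof (rule Inf_lower, rule CollectI, intro exI conjI)
      show "is_path V E (w # p2)"
        using path(1) succ(2) by (simp add: is_path_def split)
    qed (use path(3) x in \<open>auto simp: split\<close>)
    finally have "path_cost x q + h w \<le> path_cost x p"
      using cost_q path_cost_split[of x p1 w p2] by (simp add: split)
    moreover have "min (R_opt E X h s S (out_nbrs E S - {d})) (R_opt E X h s S {d})
                   \<le> ereal (path_cost x q + h w)"
    proof (cases "w = d")
      case True
      then show ?thesis
        using R[of "{d}"] assms(11) by (simp add: min.coboundedI2)
    next
      case False
      then show ?thesis
        using R[of "out_nbrs E S - {d}"] nbr \<open>finite (out_nbrs E S)\<close>
        by (simp add: min.coboundedI1)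
    qed
    ultimately show ?thesis
      by (meson ereal_less_eq(3) order_trans)
  qed
  then show ?thesis
    unfolding C_opt_def by (intro Inf_greatest) blast
qed

end
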